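(* Let $(\mathbb{C}^r/G,[\mathbf{0}])$, $r\geq 4$, be a Gorenstein abelian quotient singularity, i.e. $G$ is a finite abelian subgroup of $\mathrm{SL}(r,\mathbb{C})$ acting by diagonal matrices; let $l=|G|$ and let $\mathfrak{s}_G$ be the corresponding junior simplex. If $\mathfrak{s}_G$ has a basic triangulation (with respect to $N_G$), then $$l\leq \mathfrak{f}_3\big(\mathrm{CycP}_4(\sharp(\mathfrak{s}_G\cap N_G))\big)-2\,\sharp(\mathfrak{B}_G(1,2))-\sharp(\mathfrak{B}_G(1,3))-1\qquad\text{for } r=4,$$ and $$l\leq \mathfrak{f}_{r-1}\big(\mathrm{CycP}_r(\sharp(\mathfrak{s}_G\cap N_G))\big)-\sum_{k=2}^{r-1}\sharp(\mathfrak{B}_G(1,k))-1\qquad\text{for } r\geq 5.$$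
   Context: Let $G\subset\mathrm{SL}(r,\mathbb{C})$ be a finite abelian group, with coordinates of $\mathbb{C}^r$ chosen so that $G$ consists of diagonal matrices. $N_G:=\{(y_1,\ldots,y_r)^{\intercal}\in\mathbb{R}^r : \mathrm{diag}(e^{2\pi\sqrt{-1}y_1},\ldots,e^{2\pi\sqrt{-1}y_r})\in G\}$ is a lattice containing $\mathbb{Z}^r$, and $\mathfrak{s}_G:=\mathrm{conv}(\{e_1,\ldots,e_r\})$ is the junior simplex. Each $g\in G$ is uniquely of the form $g=\mathrm{diag}(e^{2\pi\sqrt{-1}\gamma_1},\ldots,e^{2\pi\sqrt{-1}\gamma_r})$ with $\gamma_j\in\mathbb{Q}\cap[0,1)$. Put $\mathrm{age}(g):=\gamma_1+\cdots+\gamma_r$, $\mathrm{ht}(g):=\mathrm{rank}(g-\mathrm{Id})=\sharp\{j:\gamma_j\neq 0\}$, and $\mathfrak{B}_G(i,k):=\{g\in G : \mathrm{age}(g)=i,\ \mathrm{ht}(g)=k\}$. A lattice triangulation of $\mathfrak{s}_G$ is a (geometric) triangulation of $\mathfrak{s}_G$ with all vertices in $N_G$. A lattice simplex is basic w.r.t. $N_G$ if its vertices constitute a part of a $\mathbb{Z}$-basis of $N_G$; a lattice triangulation is basic if all of its simplices are basic. $\mathrm{CycP}_d(k)$ denotes the cyclic $d$-polytope with $k$ vertices and $\mathfrak{f}_{d-1}(\mathrm{CycP}_d(k))$ the number of its facets, given by $$\mathfrak{f}_{d-1}(\mathrm{CycP}_d(k))=\binom{k-\lceil d/2\rceil}{\lfloor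 d/2\rfloor}+\binom{k-1-\lceil (d-1)/2\rceil}{\lfloor (d-1)/2\rfloor}$$ (this formula is used as the meaning of the left-hand side also for $k=d$). *)

theory Defs
  imports "HOL-Analysis.Analysis" "HOL-Algebra.Group"
begin

text \<open>
  Throughout, the dimension \<open>r\<close> is \<open>CARD('n)\<close> and the coordinates are indexed by \<open>'n\<close>.
\<close>

definition special_linear :: "(complex^'n^'n) monoid" where
  "special_linear = \<lparr>carrier = {A. det A = 1}, mult = (**), one = mat 1\<rparr>"

definition diag :: "('n \<Rightarrow> 'a::zero) \<Rightarrow> 'a^'n^'n" where
  "diag d = (\<chi> i j. if i = j then d i else 0)"

definition is_diagonal :: "'a::zero^'n^'n \<Rightarrow> bool" where
  "is_diagonal A \<longleftrightarrow> (\<exists>d. A = diag d)"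

definition lattice_N :: "(complex^'n^'n) set \<Rightarrow> (real^'n) set" where
  "lattice_N G = {y. diag (\<lambda>j. exp (2 * of_real pi * \<i> * of_real (y $ j))) \<in> G}"

definition junior_simplex :: "(real^'n) set" where
  "junior_simplex = convex hull (range (\<lambda>j. axis j 1))"

text \<open>
  The exponents \<open>\<gamma>\<^sub>j\<close> exist, and are then unique, when \<open>g\<close> is a diagonal matrix of finite
  order; \<open>gamma\<close> and \<open>age\<close> are only meant for such \<open>g\<close>.
\<close>

definition gamma :: "complex^'n^'n \<Rightarrow> 'n \<Rightarrow> real" where
  "gamma g j = (THE x. x \<in> \<rat> \<and> 0 \<le> x \<and> x < 1 \<and> g $ j $ j = exp (2 * of_real pi * \<i> * of_real x))"

definition age :: "complex^'n^'n \<Rightarrow> real" where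
  "age g = (\<Sum>j\<in>UNIV. gamma g j)"

definition ht :: "complex^'n^'n \<Rightarrow> nat" where
  "ht g = rank (g - mat 1)"

definition age_ht_class :: "(complex^'n^'n) set \<Rightarrow> nat \<Rightarrow> nat \<Rightarrow> (complex^'n^'n) set" where
  "age_ht_class G i k = {g \<in> G. age g = real i \<and> ht g = k}"

definition vertices :: "'a::euclidean_space set \<Rightarrow> 'a set" where
  "vertices S = {v. v extreme_point_of S}"

text \<open>
  \<open>simplicial_complex\<close> asks for closure under all faces, so the collection \<open>T\<close> also contains
  the empty simplex and the simplices of lower dimension.
\<close>

definition lattice_triangulation :: "'a::euclidean_space set \<Rightarrow> 'a set \<Rightarrow> 'a set set \<Rightarrow> bool" where
  "lattice_triangulation L P T \<longleftrightarrow>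
     simplicial_complex T \<and> \<Union>T = P \<and> (\<forall>S\<in>T. vertices S \<subseteq> L)"

text \<open>
  \<open>module.span\<close> and \<open>module.dependent\<close> are instantiated with integer scalars: the span
  consists of the finite integral linear combinations, and dependence means a nontrivial
  integral relation.
\<close>

definition int_scale :: "int \<Rightarrow> 'a::real_vector \<Rightarrow> 'a" where
  "int_scale m x = of_int m *\<^sub>R x"

definition is_int_basis :: "'a::real_vector set \<Rightarrow> 'a set \<Rightarrow> bool" where
  "is_int_basis L B \<longleftrightarrow> \<not> module.dependent int_scale B \<and> module.span int_scale B = L"

interpretation int_module: module "int_scale :: int \<Rightarrow> 'a::real_vector \<Rightarrow> 'a"
  by unfold_locales (simp_all add: int_scale_def algebra_simps)

definition basic_simplex :: "'a::euclidean_space set \<Rightarrow> 'a set \<Rightarrow> bool" where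
  "basic_simplex L S \<longleftrightarrow> (\<exists>B. is_int_basis L B \<and> vertices S \<subseteq> B)"

definition basic_triangulation :: "'a::euclidean_space set \<Rightarrow> 'a set \<Rightarrow> 'a set set \<Rightarrow> bool" where
  "basic_triangulation L P T \<longleftrightarrow>
     lattice_triangulation L P T \<and> (\<forall>S\<in>T. basic_simplex L S)"

text \<open>
  The number of facets of the cyclic \<open>d\<close>-polytope with \<open>k\<close> vertices, given by its closed
  formula, which is also taken as the meaning in the degenerate case \<open>k = d\<close>. It is meant for
  \<open>k \<ge> d \<ge> 1\<close>, where the subtractions of natural numbers are not truncated.
\<close>

definition cyclic_polytope_facets :: "nat \<Rightarrow> nat \<Rightarrow> nat" where
  "cyclic_polytope_facets d k =
     ((k - nat \<lceil>real d / 2\<rceil>) choose nat \<lfloor>real d / 2\<rfloor>) +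
     ((k - 1 - nat \<lceil>(real d - 1) / 2\<rceil>) choose nat \<lfloor>(real d - 1) / 2\<rfloor>)"

end

theory Submission
  imports Defs "HOL-Library.Multiset"
begin

text \<open>
  Write \<open>r\<close> for the dimension and \<open>n\<close> for the number of lattice points of the junior simplex.
  Reading off exponents identifies \<open>G\<close> with the lattice points of the half-open unit cube, the age
  being the coordinate sum. If the junior simplex has a basic triangulation, then every lattice point
  of the positive orthant with coordinate sum \<open>i\<close> is a sum of \<open>i\<close> lattice points of the
  simplex; for points of the half-open cube these summands are among the \<open>n - r\<close> elements of age 1.
  Counting multisets bounds the number of elements of age \<open>i\<close> by \<open>(n - r + i - 1) choose i\<close>. The
  same bound holds for age \<open>r - i\<close>: the inverse of such an element has age at most \<open>i\<close>, and its
  age is determined by its support, so that a decomposition of it can be padded to size \<open>i\<close>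
  without losing information. Moreover the elements of age \<open>r - 1\<close> are the inverses of those of
  age 1 and height \<open>r\<close>. Summing the bounds for age at most \<open>r div 2\<close> and the dual bounds for the
  remaining ages gives the number of facets of the cyclic polytope, minus the correction terms.
\<close>

subsection \<open>Generation by lattice points of the junior simplex\<close>

definition coord_sum :: "real^'n \<Rightarrow> real" where
  "coord_sum x = (\<Sum>j\<in>UNIV. x $ j)"

lemma coord_sum_zero [simp]: "coord_sum 0 = 0"
  by (simp add: coord_sum_def)

lemma coord_sum_add [simp]: "coord_sum (x + y) = coord_sum x + coord_sum y"
  by (simp add: coord_sum_def sum.distrib)

lemma coord_sum_scaleR [simp]: "coord_sum (c *\<^sub>R x) = c * coord_sum x"
  by (simp add: coord_sum_def sum_distrib_left)

lemma coord_sum_sum [simp]: "coord_sum (sum f A) = (\<Sum>a\<in>A. coord_sum (f a))"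
  by (induction A rule: infinite_finite_induct) auto

lemma coord_sum_axis [simp]: "coord_sum (axis j c) = c"
  by (simp add: coord_sum_def axis_def if_distrib sum.delta cong: if_cong)

lemma axis_expansion: "x = (\<Sum>j\<in>UNIV. (x $ j) *\<^sub>R axis j (1::real))"
  using basis_expansion[of x] by (simp add: scalar_mult_eq_scaleR)

lemma junior_simplex_eq: "junior_simplex = {x. (\<forall>j. 0 \<le> x $ j) \<and> coord_sum x = 1}"
proof (intro equalityI subsetI)
  fix x :: "real^'n" assume x: "x \<in> junior_simplex"
  have "0 \<le> axis j (1 :: real) $ i" for i j :: 'n
    by (simp add: axis_def)
  then have "junior_simplex \<subseteq> {x :: real^'n. (\<forall>j. 0 \<le> x $ j) \<and> coord_sum x = 1}"
    unfolding junior_simplex_def by (intro hull_minimal) (auto simp: convex_def)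
  then show "x \<in> {x. (\<forall>j. 0 \<le> x $ j) \<and> coord_sum x = 1}" using x by blast
next
  fix x :: "real^'n" assume x: "x \<in> {x. (\<forall>j. 0 \<le> x $ j) \<and> coord_sum x = 1}"
  have "(\<Sum>j\<in>UNIV. (x $ j) *\<^sub>R axis j (1::real)) \<in> convex hull (range (\<lambda>j. axis j 1))"
    using x by (intro convex_sum) (auto simp: coord_sum_def intro: hull_inc)
  then show "x \<in> junior_simplex"
    using axis_expansion[of x] by (simp add: junior_simplex_def)
qed

text \<open>
  A \<open>\<int>\<close>-basis of a lattice between \<open>\<int>\<^sup>n\<close> and \<open>\<rat>\<^sup>n\<close> is linearly independent
  over \<open>\<real>\<close>: the integral coordinate functions of the basis extend to \<open>\<real>\<close>-linear functionals
  that are determined by their values on the unit vectors.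
\<close>

lemma int_basis_real_coefficient:
  fixes L :: "(real^'n) set"
  assumes basis: "is_int_basis L B"
    and axis: "\<And>j. axis j 1 \<in> L"
    and rational: "\<And>x. x \<in> L \<Longrightarrow> \<exists>N>0. \<forall>j. real N * x $ j \<in> \<int>"
    and V: "finite V" "V \<subseteq> B" and b: "b \<in> V"
    and mem: "(\<Sum>v\<in>V. c v *\<^sub>R v) \<in> L"
  shows "c b \<in> \<int>"
proof -
  have indep: "int_module.independent B" and span: "int_module.span B = L"
    using basis by (auto simp: is_int_basis_def)
  define R where "R = int_module.representation B"
  define \<phi> where "\<phi> x = (\<Sum>j\<in>UNIV. x $ j * of_int (R (axis j 1) b))" for x :: "real^'n"
  have \<phi>_sum: "\<phi> (\<Sum>v\<in>V. c v *\<^sub>R v) = (\<Sum>v\<in>V. c v * \<phi> v)"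
    by (simp add: \<phi>_def sum_distrib_right sum_distrib_left mult.assoc) (rule sum.swap)
  \<comment> \<open>Some integer multiple of \<open>x\<close> is an integral combination of unit
    vectors, where \<open>\<phi>\<close> and the \<open>b\<close>-coordinate agree by construction;
    dividing by \<open>N\<close> carries this over to \<open>x\<close>.\<close>
  have \<phi>_eq: "\<phi> x = of_int (R x b)" if "x \<in> L" for x
  proof -
    obtain N where N: "N > 0" "\<forall>j. real N * x $ j \<in> \<int>"
      using rational \<open>x \<in> L\<close> by blast
    then obtain k where k: "\<And>j. real N * x $ j = of_int (k j)"
      unfolding Ints_def image_iff by metis
    have "int_scale (int N) x = (\<Sum>j\<in>UNIV. int_scale (k j) (axis j 1))"
      by (subst axis_expansion[of x]) (simp add: int_scale_def scaleR_sum_right k)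
    then have "R (int_scale (int N) x) b = R (\<Sum>j\<in>UNIV. int_scale (k j) (axis j 1)) b"
      by simp
    then have "int N * R x b = (\<Sum>j\<in>UNIV. k j * R (axis j 1) b)"
      unfolding R_def using indep that axis unfolding span[symmetric]
      by (simp add: int_module.representation_scale int_module.representation_sum int_module.span_scale)
    then have "real N * of_int (R x b) = (\<Sum>j\<in>UNIV. of_int (k j) * of_int (R (axis j 1) b))"
      by (metis (no_types, lifting) of_int_mult of_int_of_nat_eq of_int_sum sum.cong)
    also have "\<dots> = real N * \<phi> x"
      by (simp add: \<phi>_def sum_distrib_left k flip: mult.assoc)
    finally show ?thesis using N by simp
  qed
  have \<phi>_V: "\<phi> v = (if v = b then 1 else 0)" if "v \<in> V" for v
  proof -
    have "v \<in> B" using V that by blast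
    then have "v \<in> L" using span int_module.span_base by blast
    then show ?thesis using \<open>v \<in> B\<close> indep
      by (simp add: \<phi>_eq R_def int_module.representation_basis)
  qed
  have "\<phi> (\<Sum>v\<in>V. c v *\<^sub>R v) = (\<Sum>v\<in>V. if v = b then c v else 0)"
    unfolding \<phi>_sum by (intro sum.cong) (auto simp: \<phi>_V)
  then have "\<phi> (\<Sum>v\<in>V. c v *\<^sub>R v) = c b"
    using V b by simp
  then show ?thesis using \<phi>_eq[OF mem] by (metis Ints_of_int)
qed

lemma sum_mset_replicate_mset_scaleR:
  "sum_mset (replicate_mset n (x :: 'a :: real_vector)) = real n *\<^sub>R x"
  by (induction n) (simp_all add: algebra_simps)

text \<open>Scaling \<open>y\<close> by \<open>1 / i\<close> puts it into some simplex
  \<open>S\<close> of the triangulation. After scaling back, its barycentric coordinates are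
  integers because the vertices of \<open>S\<close> belong to a lattice basis, so they serve as
  multiplicities.\<close>

lemma basic_triangulation_generates:
  fixes L :: "(real^'n) set"
  assumes basic: "basic_triangulation L junior_simplex T"
    and axis: "\<And>j. axis j 1 \<in> L"
    and rational: "\<And>x. x \<in> L \<Longrightarrow> \<exists>N>0. \<forall>j. real N * x $ j \<in> \<int>"
    and y: "y \<in> L" "\<forall>j. 0 \<le> y $ j" "coord_sum y = real i"
  shows "\<exists>M. size M = i \<and> set_mset M \<subseteq> junior_simplex \<inter> L \<and> \<Sum>\<^sub># M = y"
proof (cases "i = 0")
  case True
  then have "y = 0"
    using y by (auto simp: coord_sum_def sum_nonneg_eq_0_iff vec_eq_iff)
  then show ?thesis using True by (intro exI[of _ "{#}"]) auto
next
  case False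
  have T: "simplicial_complex T" "\<Union>T = junior_simplex" "\<And>S. S \<in> T \<Longrightarrow> vertices S \<subseteq> L"
    "\<And>S. S \<in> T \<Longrightarrow> basic_simplex L S"
    using basic by (auto simp: basic_triangulation_def lattice_triangulation_def)
  have "(1 / real i) *\<^sub>R y \<in> junior_simplex"
    using y False by (auto simp: junior_simplex_eq)
  then obtain S where S: "S \<in> T" "(1 / real i) *\<^sub>R y \<in> S" using T(2) by blast
  obtain n where "n simplex S" using T(1) S by (auto simp: simplicial_complex_def)
  then have "convex hull (vertices S) = S"
    unfolding vertices_def
    by (intro Krein_Milman_Minkowski[symmetric] polytope_imp_compact polytope_imp_convex simplex_imp_polytope)
  with S(2) have "(1 / real i) *\<^sub>R y \<in> convex hull (vertices S)" by simp
  then obtain V u where V: "finite V" "V \<subseteq> vertices S" "\<And>v. v \<in> V \<Longrightarrow> 0 \<le> u v"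
    "(\<Sum>v\<in>V. u v *\<^sub>R v) = (1 / real i) *\<^sub>R y"
    unfolding convex_hull_explicit by blast
  define c where "c v = real i * u v" for v
  have "(\<Sum>v\<in>V. c v *\<^sub>R v) = real i *\<^sub>R (\<Sum>v\<in>V. u v *\<^sub>R v)"
    by (simp add: c_def scaleR_sum_right)
  then have y_eq: "(\<Sum>v\<in>V. c v *\<^sub>R v) = y"
    using V(4) False by simp
  obtain B where B: "is_int_basis L B" "vertices S \<subseteq> B"
    using T(4)[OF S(1)] by (auto simp: basic_simplex_def)
  have "\<exists>k::nat. c v = real k" if "v \<in> V" for v
  proof -
    have "c v \<in> \<int>"
      using B V y y_eq that by (intro int_basis_real_coefficient[OF B(1) axis rational, of V]) auto
    moreover have "0 \<le> c v" using V that by (simp add: c_def)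
    ultimately show ?thesis by (metis Ints_cases of_int_0_le_iff of_int_of_nat_eq zero_le_imp_eq_int)
  qed
  then obtain k where k: "\<And>v. v \<in> V \<Longrightarrow> c v = real (k v)" by metis
  have V_sub: "V \<subseteq> junior_simplex \<inter> L"
    using V T(2,3) S(1) by (fastforce simp: vertices_def extreme_point_of_def)
  define M where "M = (\<Sum>v\<in>V. replicate_mset (k v) v)"
  have sum_M: "\<Sum>\<^sub># M = y"
  proof -
    have "\<Sum>\<^sub># M = (\<Sum>v\<in>V. real (k v) *\<^sub>R v)"
      unfolding M_def using V(1)
      by (induction V) (simp_all add: sum_mset_replicate_mset_scaleR del: sum_mset_replicate_mset)
    then show ?thesis using y_eq k by simp
  qed
  \<comment> \<open>Every vertex has coordinate sum 1, so the multiplicities add up to the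
    coordinate sum of \<open>y\<close>.\<close>
  have "real (size M) = (\<Sum>v\<in>V. c v * coord_sum v)"
    unfolding M_def using V_sub k by (auto simp: junior_simplex_eq intro!: sum.cong)
  also have "\<dots> = real i" using y(3) unfolding y_eq[symmetric] by simp
  finally have "size M = i" by simp
  moreover have "set_mset M \<subseteq> V"
    unfolding M_def using V(1) by (auto simp: set_mset_sum split: if_splits)
  ultimately show ?thesis using sum_M V_sub by blast
qed

subsection \<open>Lattice points of the half-open cube\<close>

definition support :: "real^'n \<Rightarrow> 'n set" where
  "support x = {j. x $ j \<noteq> 0}"

text \<open>On the half-open cube this is the representative of \<open>- x\<close> modulo integral
  vectors, that is, the exponent vector of the inverse group element.\<close>

definition reflect :: "real^'n \<Rightarrow> real^'n" where
  "reflect x = (\<chi> j. if x $ j = 0 then 0 else 1 - x $ j)"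

lemma support_reflect:
  assumes "\<And>j. x $ j < 1"
  shows "support (reflect x) = support x"
  using less_imp_neq[OF assms] by (auto simp: support_def reflect_def)

lemma reflect_reflect:
  assumes "\<And>j. x $ j < 1"
  shows "reflect (reflect x) = x"
  using less_imp_neq[OF assms] by (auto simp: reflect_def vec_eq_iff)

text \<open>In terms of the group: the ages of an element and its inverse add up to their common
  height.\<close>

lemma coord_sum_reflect: "coord_sum (reflect x) = real (card (support x)) - coord_sum x"
proof -
  have "coord_sum (reflect x) + coord_sum x = (\<Sum>j\<in>UNIV. if x $ j \<noteq> 0 then 1 else 0)"
    unfolding coord_sum_def sum.distrib[symmetric] by (intro sum.cong) (auto simp: reflect_def)
  also have "\<dots> = real (card (support x))"
    by (simp add: support_def sum.If_cases)
  finally show ?thesis by simp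
qed

text \<open>Nonnegative coordinates cannot cancel.\<close>

lemma support_sum_mset:
  fixes M :: "(real^'n) multiset"
  assumes "\<And>x j. x \<in># M \<Longrightarrow> 0 \<le> x $ j"
  shows "support (\<Sum>\<^sub># M) = (\<Union>x\<in>set_mset M. support x)"
    and "x \<in># M \<Longrightarrow> x $ j \<le> (\<Sum>\<^sub># M) $ j"
proof -
  have nonneg: "0 \<le> (\<Sum>\<^sub># M) $ j" if "\<And>x j. x \<in># M \<Longrightarrow> 0 \<le> x $ j" for M :: "(real^'n) multiset" and j
    using that by (induction M) auto
  show "support (\<Sum>\<^sub># M) = (\<Union>x\<in>set_mset M. support x)"
    using assms
  proof (induction M)
    case (add x M)
    have "0 \<le> x $ j" "0 \<le> (\<Sum>\<^sub># M) $ j" for j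
      using add.prems nonneg[of M] by auto
    then have "support (\<Sum>\<^sub># (add_mset x M)) = support x \<union> support (\<Sum>\<^sub># M)"
      by (auto simp: support_def add_nonneg_eq_0_iff)
    then show ?case using add by simp
  qed (simp add: support_def)
  show "x $ j \<le> (\<Sum>\<^sub># M) $ j" if "x \<in># M"
  proof -
    obtain N where "M = add_mset x N" using \<open>x \<in># M\<close> by (meson mset_add)
    then show ?thesis using assms nonneg[of N j] by simp
  qed
qed

text \<open>The properties of \<open>lattice_N G\<close> on which the counting rests:
  \<open>coord_sum_Ints\<close> reflects determinant 1, \<open>finite_half_open_cube\<close> the
  finiteness of the group, and \<open>generated\<close> is what a basic triangulation
  provides.\<close>

locale junior_lattice =
  fixes L :: "(real^'n) set"
  assumes add_mem: "\<lbrakk>x \<in> L; y \<in> L\<rbrakk> \<Longrightarrow> x + y \<in> L"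
    and minus_mem: "x \<in> L \<Longrightarrow> - x \<in> L"
    and axis_mem: "axis j 1 \<in> L"
    and coord_sum_Ints: "x \<in> L \<Longrightarrow> coord_sum x \<in> \<int>"
    and finite_half_open_cube: "finite {x \<in> L. \<forall>j. 0 \<le> x $ j \<and> x $ j < 1}"
    and generated: "\<lbrakk>y \<in> L; \<forall>j. 0 \<le> y $ j; coord_sum y = real i\<rbrakk>
      \<Longrightarrow> \<exists>M. size M = i \<and> set_mset M \<subseteq> junior_simplex \<inter> L \<and> \<Sum>\<^sub># M = y"
begin

definition cube :: "(real^'n) set" where
  "cube = {x \<in> L. \<forall>j. 0 \<le> x $ j \<and> x $ j < 1}"

text \<open>These are the exponent vectors of the elements of age \<open>i\<close>. The height being
  the size of the support, \<open>juniors_of_height k\<close> stands for the class of age 1 and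
  height \<open>k\<close>.\<close>

definition level :: "nat \<Rightarrow> (real^'n) set" where
  "level i = {x \<in> cube. coord_sum x = real i}"

definition juniors_of_height :: "nat \<Rightarrow> (real^'n) set" where
  "juniors_of_height k = {x \<in> level 1. card (support x) = k}"

lemma cubeD: "x \<in> cube \<Longrightarrow> x \<in> L" "x \<in> cube \<Longrightarrow> 0 \<le> x $ j" "x \<in> cube \<Longrightarrow> x $ j < 1"
  by (auto simp: cube_def)

lemma levelD: "x \<in> level i \<Longrightarrow> x \<in> cube" "x \<in> level i \<Longrightarrow> coord_sum x = real i"
  by (auto simp: level_def)

lemma finite_cube [simp, intro]: "finite cube"
  using finite_half_open_cube by (simp add: cube_def)

lemma finite_level [simp, intro]: "finite (level i)"
  by (simp add: level_def)

lemma zero_mem: "0 \<in> L"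
  using add_mem[OF axis_mem minus_mem[OF axis_mem]] by (metis add.right_inverse)

lemma finite_juniors_of_height [simp, intro]: "finite (juniors_of_height k)"
  by (simp add: juniors_of_height_def)

lemma sum_mem: "(\<And>i. i \<in> A \<Longrightarrow> f i \<in> L) \<Longrightarrow> sum f A \<in> L"
  by (induction A rule: infinite_finite_induct) (auto intro: add_mem zero_mem)

lemma reflect_cube:
  assumes "x \<in> cube"
  shows "reflect x \<in> cube"
proof -
  have "reflect x = (\<Sum>j\<in>support x. axis j 1) + - x"
    by (auto simp: reflect_def vec_eq_iff support_def axis_def)
  also have "\<dots> \<in> L"
    using assms by (intro add_mem sum_mem minus_mem axis_mem cubeD)
  finally have "reflect x \<in> L" .
  moreover have "0 \<le> reflect x $ j \<and> reflect x $ j < 1" for j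
    using cubeD(2,3)[OF assms, of j] by (auto simp: reflect_def)
  ultimately show ?thesis by (simp add: cube_def)
qed

text \<open>Every coordinate is below 1; strictness comes from the support being nonempty.\<close>

lemma coord_sum_less_card_support:
  assumes "x \<in> cube" "x \<noteq> 0"
  shows "coord_sum x < card (support x)"
proof -
  have "coord_sum x = (\<Sum>j\<in>support x. x $ j)"
    unfolding coord_sum_def by (rule sum.mono_neutral_right) (auto simp: support_def)
  also have "\<dots> < (\<Sum>j\<in>support x. 1)"
    using assms by (intro sum_strict_mono) (auto simp: support_def vec_eq_iff cube_def)
  finally show ?thesis by simp
qed

lemma level_0: "level 0 = {0}"
proof -
  have "x = 0" if "x \<in> level 0" for x
    using that by (auto simp: level_def cube_def coord_sum_def sum_nonneg_eq_0_iff vec_eq_iff)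
  then show ?thesis by (auto simp: level_def cube_def zero_mem)
qed

text \<open>Coordinate sums are integers and stay below the dimension, so the listed levels exhaust
  the cube.\<close>

lemma card_cube: "card cube = (\<Sum>i<CARD('n). card (level i))"
proof -
  have "\<exists>i<CARD('n). x \<in> level i" if x: "x \<in> cube" for x
  proof -
    have "0 \<le> coord_sum x" using x by (simp add: coord_sum_def sum_nonneg cubeD)
    moreover have "coord_sum x < CARD('n)"
    proof (cases "x = 0")
      case False
      have "card (support x) \<le> CARD('n)" by (simp add: card_mono)
      then show ?thesis using coord_sum_less_card_support[OF x False] by simp
    qed simp
    moreover obtain m where m: "coord_sum x = of_int m"
      using coord_sum_Ints x cubeD(1) Ints_cases by metis
    ultimately have "nat m < CARD('n)" "coord_sum x = real (nat m)" by auto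
    then show ?thesis using x by (auto simp: level_def)
  qed
  then have "cube = (\<Union>i<CARD('n). level i)" by (auto dest: levelD)
  moreover have "card (\<Union>i<CARD('n). level i) = (\<Sum>i<CARD('n). card (level i))"
    by (intro card_UN_disjoint) (auto simp: level_def)
  ultimately show ?thesis by simp
qed

text \<open>A coordinate that reaches 1 uses up the whole coordinate sum, so the point is then a
  unit vector.\<close>

lemma junior_simplex_Int_lattice:
  "junior_simplex \<inter> L = level 1 \<union> range (\<lambda>j. axis j 1)"
proof (intro equalityI subsetI)
  fix x assume x: "x \<in> junior_simplex \<inter> L"
  show "x \<in> level 1 \<union> range (\<lambda>j. axis j 1)"
  proof (cases "\<forall>j. x $ j < 1")
    case True
    then show ?thesis using x by (auto simp: junior_simplex_eq level_def cube_def)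
  next
    case False
    then obtain j where j: "x $ j \<ge> 1" by (auto simp: not_less)
    have "coord_sum x = x $ j + (\<Sum>i\<in>UNIV - {j}. x $ i)"
      unfolding coord_sum_def by (rule sum.remove) auto
    moreover have "0 \<le> (\<Sum>i\<in>UNIV - {j}. x $ i)"
      using x by (intro sum_nonneg) (auto simp: junior_simplex_eq)
    ultimately have "x $ j = 1" "(\<Sum>i\<in>UNIV - {j}. x $ i) = 0"
      using j x by (auto simp: junior_simplex_eq)
    moreover from this have "\<forall>i\<in>UNIV - {j}. x $ i = 0"
      using x by (subst (asm) sum_nonneg_eq_0_iff) (auto simp: junior_simplex_eq)
    ultimately have "x = axis j 1" by (auto simp: vec_eq_iff axis_def)
    then show ?thesis by blast
  qed
next
  fix x assume "x \<in> level 1 \<union> range (\<lambda>j. axis j 1)"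
  then show "x \<in> junior_simplex \<inter> L"
  proof
    assume "x \<in> range (\<lambda>j. axis j 1)"
    then show ?thesis using axis_mem by (auto simp: junior_simplex_def intro: hull_inc)
  qed (auto simp: level_def cube_def junior_simplex_eq)
qed

lemma card_junior_simplex_Int_lattice: "card (junior_simplex \<inter> L) = card (level 1) + CARD('n)"
proof -
  have "axis j 1 \<notin> level 1" for j
  proof
    assume "axis j 1 \<in> level 1"
    then have "axis j (1::real) $ j < 1" by (blast dest: levelD cubeD)
    then show False by simp
  qed
  moreover have "card (range (\<lambda>j. axis j (1::real) :: real^'n)) = CARD('n)"
    by (intro card_image) (auto simp: inj_on_def axis_eq_axis)
  ultimately show ?thesis
    unfolding junior_simplex_Int_lattice by (subst card_Un_disjoint) auto
qed

text \<open>The unit vectors cannot occur in such a sum, as all coordinates of \<open>y\<close> are below 1.\<close>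

lemma level_generated:
  assumes y: "y \<in> level i"
  shows "\<exists>M \<in> multisets_of_size (level 1) i. \<Sum>\<^sub># M = y"
proof -
  obtain M where M: "size M = i" "set_mset M \<subseteq> junior_simplex \<inter> L" "\<Sum>\<^sub># M = y"
    using generated[of y i] y by (auto simp: level_def cube_def)
  have "x \<in> level 1" if "x \<in># M" for x
  proof -
    have "x $ j \<le> y $ j" for j
      using support_sum_mset(2)[of M x j] M that by (auto simp: junior_simplex_eq)
    then have "x $ j < 1" for j
      using y by (meson cubeD(3) levelD(1) le_less_trans)
    then show ?thesis using M that by (auto simp: level_def cube_def junior_simplex_eq)
  qed
  then show ?thesis using M by (auto simp: multisets_of_size_def)
qed

section \<open>Bounds for the levels by counting multisets of juniors\<close>

lemma card_level_le: "card (level i) \<le> (card (level 1) + i - 1) choose i"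
proof -
  have "level i \<subseteq> sum_mset ` multisets_of_size (level 1) i"
    using level_generated by blast
  then show ?thesis
    using surj_card_le[OF finite_multisets_of_size] card_multisets_of_size by (metis finite_level)
qed

text \<open>The double \<open>u + u\<close> of a junior element \<open>u\<close> of height 2 has support of size 2 and
  coordinate sum 2, which is too much for a point of the cube.\<close>

lemma card_level_2_le:
  "card (level 2) + card (juniors_of_height 2) \<le> (card (level 1) + 1) choose 2"
proof -
  let ?D = "(\<lambda>u. {#u, u#}) ` juniors_of_height 2"
  have D: "?D \<subseteq> multisets_of_size (level 1) 2"
    by (auto simp: juniors_of_height_def multisets_of_size_def)
  have "level 2 \<subseteq> sum_mset ` (multisets_of_size (level 1) 2 - ?D)"
  proof
    fix y assume y: "y \<in> level 2"
    then obtain M where M: "M \<in> multisets_of_size (level 1) 2" "\<Sum>\<^sub># M = y"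
      using level_generated by blast
    moreover have "M \<notin> ?D"
    proof
      assume "M \<in> ?D"
      then obtain u where u: "u \<in> juniors_of_height 2" "y = u + u" using M by auto
      have "support y = support u" using u by (auto simp: support_def)
      then have "card (support y) = 2" using u by (simp add: juniors_of_height_def)
      moreover have "y \<noteq> 0" using levelD[OF y] by auto
      ultimately show False using coord_sum_less_card_support[of y] levelD[OF y] by simp
    qed
    ultimately show "y \<in> sum_mset ` (multisets_of_size (level 1) 2 - ?D)" by blast
  qed
  then have "card (level 2) \<le> card (multisets_of_size (level 1) 2 - ?D)"
    by (intro surj_card_le) auto
  also have "\<dots> = ((card (level 1) + 1) choose 2) - card ?D"
    using D by (subst card_Diff_subset) (auto simp: card_multisets_of_size finite_subset)
  also have "card ?D = card (juniors_of_height 2)"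
    by (intro card_image inj_onI) (drule arg_cong[of _ _ set_mset], simp)
  finally show ?thesis
    using card_mono[OF finite_multisets_of_size[OF finite_level] D]
    by (simp add: card_multisets_of_size \<open>card ?D = card (juniors_of_height 2)\<close>)
qed

text \<open>The age \<open>a\<close> of the inverse is the height minus \<open>CARD('n) - i\<close>.
  It is at least 1 because the age of a nonzero point is below its height, and at most
  \<open>i\<close> because the height is at most \<open>CARD('n)\<close>.\<close>

lemma reflect_level:
  assumes "x \<in> level (CARD('n) - i)" "1 \<le> i" "i < CARD('n)"
  obtains a where "reflect x \<in> level a" "1 \<le> a" "a \<le> i" "card (support (reflect x)) = CARD('n) - i + a"
proof -
  have x: "x \<in> cube" "coord_sum x = real (CARD('n) - i)" using levelD[OF assms(1)] by auto
  then have "x \<noteq> 0" using assms by auto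
  then have gt: "CARD('n) - i < card (support x)"
    using coord_sum_less_card_support[OF x(1)] x(2) by simp
  have le: "card (support x) \<le> CARD('n)" by (simp add: card_mono)
  define a where "a = card (support x) - (CARD('n) - i)"
  have "reflect x \<in> level a"
    using reflect_cube[OF x(1)] x gt by (simp add: level_def coord_sum_reflect a_def of_nat_diff)
  moreover have "support (reflect x) = support x"
    using x by (intro support_reflect cubeD)
  ultimately show thesis
    using that[of a] gt le assms by (auto simp: a_def)
qed

text \<open>
  Padding a multiset with copies of one of its own elements does not change the union of the
  supports. That union, the support of \<open>reflect x\<close>, determines how many copies were added.
\<close>

lemma card_level_dual_le:
  assumes i: "1 \<le> i" "i < CARD('n)"
  shows "card (level (CARD('n) - i)) \<le> (card (level 1) + i - 1) choose i"
proof -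
  \<comment> \<open>The choice depends only on the set of elements, so it is the same before and
    after padding.\<close>
  define pick where "pick A = (SOME x. x \<in> A)" for A :: "(real^'n) set"
  \<comment> \<open>The support has size \<open>CARD('n) - i + a\<close>, so this recovers the
    number \<open>i - a\<close> of added copies.\<close>
  define padding where
    "padding N = i - (card (\<Union>x\<in>set_mset N. support x) - (CARD('n) - i))" for N :: "(real^'n) multiset"
  define f where
    "f N = reflect (\<Sum>\<^sub># (N - replicate_mset (padding N) (pick (set_mset N))))" for N
  have "level (CARD('n) - i) \<subseteq> f ` multisets_of_size (level 1) i"
  proof
    fix x assume x: "x \<in> level (CARD('n) - i)"
    obtain a where a: "reflect x \<in> level a" "1 \<le> a" "a \<le> i"
      "card (support (reflect x)) = CARD('n) - i + a"
      using reflect_level[OF x i] .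
    obtain M where M: "M \<in> multisets_of_size (level 1) a" "\<Sum>\<^sub># M = reflect x"
      using level_generated[OF a(1)] by blast
    then have nonneg: "0 \<le> z $ j" if "z \<in># M" for z j
      using that by (auto simp: multisets_of_size_def dest!: levelD(1) intro: cubeD)
    have "M \<noteq> {#}" using M a by (auto simp: multisets_of_size_def)
    then have pick: "pick (set_mset M) \<in># M"
      unfolding pick_def by (simp add: some_in_eq)
    define N where "N = M + replicate_mset (i - a) (pick (set_mset M))"
    have set_N: "set_mset N = set_mset M"
      using pick by (auto simp: N_def)
    have "(\<Union>z\<in>set_mset N. support z) = support (reflect x)"
      unfolding set_N M(2)[symmetric] using nonneg by (simp add: support_sum_mset(1))
    then have "padding N = i - a"
      using a by (simp add: padding_def)
    then have "N - replicate_mset (padding N) (pick (set_mset N)) = M"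
      unfolding set_N by (simp add: N_def)
    then have "f N = x"
      using M(2) reflect_reflect[of x] levelD(1)[OF x] by (simp add: f_def cubeD)
    moreover have "N \<in> multisets_of_size (level 1) i"
      using M a set_N by (auto simp: multisets_of_size_def N_def)
    ultimately show "x \<in> f ` multisets_of_size (level 1) i" by blast
  qed
  then have "card (level (CARD('n) - i)) \<le> card (multisets_of_size (level 1) i)"
    by (intro surj_card_le) auto
  then show ?thesis by (simp add: card_multisets_of_size)
qed

text \<open>Taking \<open>i = 1\<close> in \<open>reflect_level\<close> forces \<open>a = 1\<close>,
  so the inverse is a junior of full height.\<close>

lemma card_level_top_le:
  assumes "2 \<le> CARD('n)"
  shows "card (level (CARD('n) - 1)) \<le> card (juniors_of_height CARD('n))"
proof -
  have "level (CARD('n) - 1) \<subseteq> reflect ` juniors_of_height CARD('n)"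
  proof
    fix x assume x: "x \<in> level (CARD('n) - 1)"
    then obtain a where a: "reflect x \<in> level a" "1 \<le> a" "a \<le> 1"
        "card (support (reflect x)) = CARD('n) - 1 + a"
      using assms by (elim reflect_level) auto
    then have "reflect x \<in> juniors_of_height CARD('n)"
      by (simp add: juniors_of_height_def)
    moreover have "reflect (reflect x) = x"
      using x by (intro reflect_reflect) (auto dest: levelD cubeD)
    ultimately show "x \<in> reflect ` juniors_of_height CARD('n)" by (metis imageI)
  qed
  then show ?thesis by (intro surj_card_le) auto
qed

lemma card_level_1: "card (level 1) = (\<Sum>k = 2..CARD('n). card (juniors_of_height k))"
proof -
  have "card (support x) \<in> {2..CARD('n)}" if x: "x \<in> level 1" for x
  proof -
    have "x \<noteq> 0" using levelD[OF x] by auto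
    then have "1 < card (support x)"
      using coord_sum_less_card_support[of x] levelD[OF x] by simp
    then show ?thesis by (simp add: card_mono)
  qed
  then have "level 1 = (\<Union>k\<in>{2..CARD('n)}. juniors_of_height k)"
    by (auto simp: juniors_of_height_def)
  moreover have "card (\<Union>k\<in>{2..CARD('n)}. juniors_of_height k) = (\<Sum>k = 2..CARD('n). card (juniors_of_height k))"
    by (intro card_UN_disjoint) (auto simp: juniors_of_height_def)
  ultimately show ?thesis by simp
qed

end

subsection \<open>Summation over the levels\<close>

text \<open>Hockey-stick identity. The subtraction is truncated only for \<open>k = i = 0\<close>,
  where the binomial coefficient is 1 anyway.\<close>

lemma sum_multiset_coefficients: "(\<Sum>i\<le>p. (k + i - 1) choose i) = (k + p) choose p"
  by (induction p) simp_all

text \<open>Subtracting half of \<open>d\<close>, rounded up, from \<open>k + d\<close> leaves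
  \<open>k\<close> plus half of \<open>d\<close>, rounded down; likewise for \<open>d - 1\<close>.
  Both summands thus become totals as in \<open>sum_multiset_coefficients\<close>.\<close>

lemma cyclic_polytope_facets_eq:
  assumes "d \<ge> 1"
  shows "cyclic_polytope_facets d (k + d) =
    ((k + d div 2) choose (d div 2)) + ((k + (d - 1) div 2) choose ((d - 1) div 2))"
proof -
  have half: "nat \<lfloor>real n / 2\<rfloor> = n div 2" "nat \<lceil>real n / 2\<rceil> = n - n div 2" for n
  proof -
    show "nat \<lfloor>real n / 2\<rfloor> = n div 2" by linarith
    show "nat \<lceil>real n / 2\<rceil> = n - n div 2" by linarith
  qed
  have "real d - 1 = real (d - 1)" using assms by simp
  then show ?thesis
    using assms by (simp add: cyclic_polytope_facets_def half del: of_nat_diff)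
qed

context junior_lattice
begin

lemma card_level_1_split:
  assumes "2 \<le> CARD('n)"
  shows "card (level 1) =
    (\<Sum>k = 2..CARD('n) - 1. card (juniors_of_height k)) + card (juniors_of_height CARD('n))"
proof -
  obtain m where "CARD('n) = Suc m" "1 \<le> m" using assms by (cases "CARD('n)") auto
  then show ?thesis unfolding card_level_1 by simp
qed

text \<open>The dual bounds for \<open>i = 0\<close> and \<open>i = 1\<close> would contribute 1 and
  \<open>card (level 1)\<close>. No level is paired with \<open>i = 0\<close>, and for
  \<open>i = 1\<close> the juniors of full height suffice; this saving is the correction term
  together with the final 1.\<close>

lemma card_cube_le:
  assumes r: "3 \<le> CARD('n)"
  shows "card cube + (\<Sum>k = 2..CARD('n) - 1. card (juniors_of_height k)) + 1
    \<le> cyclic_polytope_facets CARD('n) (card (level 1) + CARD('n))"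
proof -
  define p where "p = CARD('n) div 2"
  define q where "q = (CARD('n) - 1) div 2"
  define k where "k = card (level 1)"
  \<comment> \<open>Levels \<open>0\<close> to \<open>p\<close> are bounded directly, the remaining
    \<open>q\<close> levels by reflection.\<close>
  have pq: "Suc (p + q) = CARD('n)" "1 \<le> q" using r unfolding p_def q_def by linarith+
  have "{..<CARD('n)} = {..p} \<union> {Suc p..<CARD('n)}" using pq by auto
  then have "card cube = (\<Sum>i\<in>{..p} \<union> {Suc p..<CARD('n)}. card (level i))"
    by (simp only: card_cube)
  also have "\<dots> = (\<Sum>i\<le>p. card (level i)) + (\<Sum>i = Suc p..<CARD('n). card (level i))"
    by (rule sum.union_disjoint) auto
  also have "(\<Sum>i = Suc p..<CARD('n). card (level i)) = (\<Sum>i = 1..q. card (level (CARD('n) - i)))"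
    using pq by (intro sum.reindex_bij_witness[of _ "\<lambda>i. CARD('n) - i" "\<lambda>i. CARD('n) - i"]) auto
  also have "\<dots> = card (level (CARD('n) - 1)) + (\<Sum>i = 2..q. card (level (CARD('n) - i)))"
    using pq by (simp add: sum.atLeast_Suc_atMost numeral_2_eq_2)
  also have "(\<Sum>i\<le>p. card (level i)) \<le> (\<Sum>i\<le>p. (k + i - 1) choose i)"
    unfolding k_def by (intro sum_mono card_level_le)
  also have "(\<Sum>i = 2..q. card (level (CARD('n) - i))) \<le> (\<Sum>i = 2..q. (k + i - 1) choose i)"
    unfolding k_def using pq by (intro sum_mono card_level_dual_le) auto
  also have "card (level (CARD('n) - 1)) \<le> card (juniors_of_height CARD('n))"
    using r by (intro card_level_top_le) simp
  finally have "card cube \<le> (\<Sum>i\<le>p. (k + i - 1) choose i)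
      + (card (juniors_of_height CARD('n)) + (\<Sum>i = 2..q. (k + i - 1) choose i))"
    by simp
  moreover have "k = (\<Sum>k = 2..CARD('n) - 1. card (juniors_of_height k)) + card (juniors_of_height CARD('n))"
    unfolding k_def using r by (intro card_level_1_split) simp
  moreover have "(\<Sum>i\<le>q. (k + i - 1) choose i) = 1 + k + (\<Sum>i = 2..q. (k + i - 1) choose i)"
    using pq by (simp add: atMost_atLeast0 sum.atLeast_Suc_atMost numeral_2_eq_2)
  moreover have "cyclic_polytope_facets CARD('n) (k + CARD('n)) =
      (\<Sum>i\<le>p. (k + i - 1) choose i) + (\<Sum>i\<le>q. (k + i - 1) choose i)"
    unfolding sum_multiset_coefficients p_def q_def using r by (intro cyclic_polytope_facets_eq) simp
  ultimately show ?thesis unfolding k_def by linarith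
qed

text \<open>Compared with the general bound, \<open>card_level_2_le\<close> saves the juniors of
  height 2 once more, hence the factor 2.\<close>

lemma card_cube_le_dim_4:
  assumes r: "CARD('n) = 4"
  shows "card cube + 2 * card (juniors_of_height 2) + card (juniors_of_height 3) + 1
    \<le> cyclic_polytope_facets 4 (card (level 1) + 4)"
proof -
  define k where "k = card (level 1)"
  have "card cube = 1 + k + card (level 2) + card (level 3)"
    by (simp add: card_cube r numeral_eq_Suc level_0 k_def)
  moreover have "card (level 3) \<le> card (juniors_of_height 4)"
    using card_level_top_le r by simp
  moreover have "k = card (juniors_of_height 2) + card (juniors_of_height 3) + card (juniors_of_height 4)"
  proof -
    have "{2..4} = {2, 3, 4 :: nat}" by auto
    then show ?thesis by (simp add: k_def card_level_1 r del: One_nat_def)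
  qed
  moreover have "cyclic_polytope_facets 4 (k + 4) = ((k + 1) choose 2) + 2 * (k + 1)"
  proof -
    have "cyclic_polytope_facets 4 (k + 4) = ((k + 2) choose 2) + ((k + 1) choose 1)"
      by (simp add: cyclic_polytope_facets_eq)
    also have "(k + 2) choose 2 = ((k + 1) choose 1) + ((k + 1) choose 2)"
      using binomial_Suc_Suc[of "k + 1" 1] by (simp only: numeral_2_eq_2 One_nat_def add_Suc_right add_0_right)
    finally show ?thesis by simp
  qed
  moreover have "card (level 2) + card (juniors_of_height 2) \<le> (k + 1) choose 2"
    unfolding k_def by (rule card_level_2_le)
  ultimately show ?thesis
    unfolding k_def[symmetric] by presburger
qed

end

subsection \<open>Diagonal matrices of roots of unity\<close>

definition unit_exp :: "real \<Rightarrow> complex" where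
  "unit_exp x = exp (2 * of_real pi * \<i> * of_real x)"

lemma unit_exp_add: "unit_exp (x + y) = unit_exp x * unit_exp y"
  by (simp add: unit_exp_def algebra_simps exp_add)

lemma unit_exp_0 [simp]: "unit_exp 0 = 1"
  by (simp add: unit_exp_def)

lemma unit_exp_minus: "unit_exp (- x) = inverse (unit_exp x)"
  by (simp add: unit_exp_def exp_minus)

lemma unit_exp_sum: "finite A \<Longrightarrow> unit_exp (sum f A) = (\<Prod>a\<in>A. unit_exp (f a))"
  by (induction A rule: finite_induct) (auto simp: unit_exp_add)

lemma unit_exp_of_nat_mult: "unit_exp (real n * x) = unit_exp x ^ n"
  by (induction n) (auto simp: unit_exp_add algebra_simps)

lemma unit_exp_eq_1_iff: "unit_exp x = 1 \<longleftrightarrow> x \<in> \<int>"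
proof
  assume "unit_exp x = 1"
  then obtain n :: int where "2 * pi * x = of_int (2 * n) * pi"
    by (auto simp: unit_exp_def exp_eq_1)
  then have "x = of_int n" by simp
  then show "x \<in> \<int>" by simp
next
  assume "x \<in> \<int>"
  then obtain n :: int where "x = of_int n" by (auto elim: Ints_cases)
  then show "unit_exp x = 1" by (auto simp: unit_exp_def exp_eq_1)
qed

lemma unit_exp_inj:
  assumes "unit_exp x = unit_exp y" "0 \<le> x" "x < 1" "0 \<le> y" "y < 1"
  shows "x = y"
proof -
  have "unit_exp y \<noteq> 0" by (simp add: unit_exp_def)
  then have "unit_exp (x + - y) = 1"
    using assms(1) by (simp add: unit_exp_add unit_exp_minus del: add_uminus_conv_diff)
  then obtain n :: int where "x - y = of_int n"
    unfolding unit_exp_eq_1_iff by (auto elim: Ints_cases)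
  moreover from this have "- 1 < (of_int n :: real)" "(of_int n :: real) < 1"
    using assms by linarith+
  then have "n = 0" by linarith
  ultimately show ?thesis by simp
qed

lemma root_of_unity_eq_unit_exp:
  assumes "z ^ N = 1" "N > 0"
  shows "\<exists>x. 0 \<le> x \<and> x < 1 \<and> z = unit_exp x"
proof -
  have "z \<in> {exp(2 * of_real pi * \<i> * of_nat j / of_nat N) | j. j < N}"
    using complex_roots_unity[of N] assms by auto
  then obtain j where "j < N" "z = unit_exp (real j / real N)"
    by (auto simp: unit_exp_def)
  then show ?thesis by (intro exI[of _ "real j / real N"]) auto
qed

lemma diag_nth [simp]: "diag d $ i $ j = (if i = j then d i else 0)"
  by (simp add: diag_def)

lemma diag_eq_iff: "diag a = diag b \<longleftrightarrow> a = b"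
  by (auto simp: vec_eq_iff fun_eq_iff)

lemma diag_mult: "diag a ** diag b = diag (\<lambda>j. a j * b j :: 'a :: semiring_1)"
proof -
  have "(diag a ** diag b) $ i $ j = (\<Sum>k\<in>UNIV. if k = i then a i * diag b $ i $ j else 0)" for i j
    unfolding matrix_matrix_mult_def vec_lambda_beta by (rule sum.cong) auto
  then show ?thesis by (simp add: vec_eq_iff)
qed

lemma diag_1: "diag (\<lambda>_. 1) = mat 1"
  by (auto simp: vec_eq_iff mat_def)

lemma det_diag: "det (diag d) = (\<Prod>j\<in>UNIV. d j)"
  by (subst det_diagonal) auto

text \<open>The rows span the coordinate subspace belonging to the nonzero entries.\<close>

lemma rank_diag: "rank (diag d :: 'a::field^'n^'n) = card {j. d j \<noteq> 0}"
proof -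
  let ?D = "{j. d j \<noteq> 0}"
  let ?S = "{x :: 'a^'n. \<forall>j. j \<notin> ?D \<longrightarrow> x $ j = 0}"
  have row: "row i (diag d) = d i *s axis i 1" for i
    by (auto simp: row_def vec_eq_iff axis_def)
  have "rows (diag d) \<subseteq> ?S"
    by (auto simp: rows_def row axis_def)
  then have "rows (diag d) \<subseteq> vec.span ?S"
    using vec.span_superset by blast
  moreover have "?S \<subseteq> vec.span (rows (diag d))"
  proof
    fix x assume x: "x \<in> ?S"
    have "x = (\<Sum>i\<in>UNIV. (x $ i / d i) *s row i (diag d))"
      using x by (subst basis_expansion[of x, symmetric]) (auto simp: row intro!: sum.cong)
    also have "\<dots> \<in> vec.span (rows (diag d))"
      by (intro vec.span_sum vec.span_scale vec.span_base) (auto simp: rows_def)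
    finally show "x \<in> vec.span (rows (diag d))" .
  qed
  ultimately have "vec.dim (rows (diag d)) = vec.dim ?S"
    by (intro antisym vec.dim_mono)
  then show ?thesis
    unfolding row_rank_def_gen by (simp only: dim_substandard_cart)
qed

section \<open>Finite diagonal groups and their lattices\<close>

definition exp_diag :: "real^'n \<Rightarrow> complex^'n^'n" where
  "exp_diag y = diag (\<lambda>j. unit_exp (y $ j))"

locale diagonal_group =
  fixes G :: "(complex^'n^'n) set"
  assumes subgroup: "subgroup G special_linear"
    and finite [simp]: "finite G"
    and diagonal: "\<forall>g\<in>G. is_diagonal g"
begin

lemma mult_mem: "A \<in> G \<Longrightarrow> B \<in> G \<Longrightarrow> A ** B \<in> G"
  using subgroup.m_closed[OF subgroup] by (simp add: special_linear_def)

lemma mat_1_mem: "mat 1 \<in> G"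
  using subgroup.one_closed[OF subgroup] by (simp add: special_linear_def)

lemma det_mem: "A \<in> G \<Longrightarrow> det A = 1"
  using subgroup.subset[OF subgroup] by (auto simp: special_linear_def)

lemma lattice_N_iff: "y \<in> lattice_N G \<longleftrightarrow> exp_diag y \<in> G"
  by (simp add: lattice_N_def exp_diag_def unit_exp_def)

lemma diag_power_mem:
  assumes "diag d \<in> G"
  shows "diag (\<lambda>j. d j ^ n) \<in> G"
proof (induction n)
  case (Suc n)
  then show ?case using mult_mem[OF assms Suc] by (simp add: diag_mult)
qed (simp add: diag_1 mat_1_mem)

text \<open>By finiteness two powers coincide; determinant 1 makes the diagonal entries nonzero, so
  the smaller power can be cancelled.\<close>

lemma finite_order:
  assumes "diag d \<in> G"
  shows "\<exists>N>0. \<forall>j. d j ^ N = 1"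
proof -
  have "\<not> inj (\<lambda>n. diag (\<lambda>j. d j ^ n))"
    using assms diag_power_mem finite_subset[OF _ finite, of "range (\<lambda>n. diag (\<lambda>j. d j ^ n))"]
      finite_imageD[of "\<lambda>n. diag (\<lambda>j. d j ^ n)" UNIV] by auto
  then obtain m n :: nat where mn: "m < n" "\<And>j. d j ^ m = d j ^ n"
    by (auto simp: inj_def diag_eq_iff fun_eq_iff) (metis nat_neq_iff)
  have "(\<Prod>j\<in>UNIV. d j) = 1"
    using det_mem[OF assms] by (simp add: det_diag)
  then have "d j \<noteq> 0" for j by (metis UNIV_I finite_class.finite_UNIV prod_zero_iff zero_neq_one)
  then have "d j ^ (n - m) = 1" for j
    using mn(2)[of j] mn(1) by (simp add: power_diff)
  then show ?thesis using mn(1) by (intro exI[of _ "n - m"]) auto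
qed

text \<open>Finite order makes the inverse a power.\<close>

lemma diag_inverse_mem:
  assumes "diag d \<in> G"
  shows "diag (\<lambda>j. inverse (d j)) \<in> G"
proof -
  obtain N where N: "N > 0" "\<And>j. d j ^ N = 1" using finite_order[OF assms] by auto
  have "d j * d j ^ (N - 1) = 1" for j
    using N by (metis power_eq_if less_not_refl)
  then have "inverse (d j) = d j ^ (N - 1)" for j
    by (metis inverse_unique)
  then show ?thesis using diag_power_mem[OF assms, of "N - 1"] by simp
qed

lemma lattice_N_rational:
  assumes "y \<in> lattice_N G"
  shows "\<exists>N>0. \<forall>j. real N * y $ j \<in> \<int>"
  using finite_order[OF assms[unfolded lattice_N_iff exp_diag_def]]
  by (simp only: unit_exp_eq_1_iff flip: unit_exp_of_nat_mult)

lemma lattice_N_Rats: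
  assumes "y \<in> lattice_N G"
  shows "y $ j \<in> \<rat>"
proof -
  obtain N where N: "N > 0" "real N * y $ j \<in> \<int>" using lattice_N_rational[OF assms] by blast
  then have "real N * y $ j / real N \<in> \<rat>"
    by (intro Rats_divide) (auto simp: Ints_subset_Rats[THEN subsetD])
  then show ?thesis using N by simp
qed

text \<open>The diagonal entries are roots of unity, so exponents in the half-open unit interval
  exist; \<open>unit_exp_inj\<close> makes them unique.\<close>

lemma bij_betw_exp_diag:
  "bij_betw exp_diag {y \<in> lattice_N G. \<forall>j. 0 \<le> y $ j \<and> y $ j < 1} G"
proof (rule bij_betwI')
  fix x y assume "x \<in> {y \<in> lattice_N G. \<forall>j. 0 \<le> y $ j \<and> y $ j < 1}"
    "y \<in> {y \<in> lattice_N G. \<forall>j. 0 \<le> y $ j \<and> y $ j < 1}"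
  then show "exp_diag x = exp_diag y \<longleftrightarrow> x = y"
    by (auto simp: exp_diag_def diag_eq_iff fun_eq_iff vec_eq_iff intro: unit_exp_inj)
next
  fix g assume g: "g \<in> G"
  then obtain d where d: "g = diag d" using diagonal by (auto simp: is_diagonal_def)
  then obtain N where N: "N > 0" "\<And>j. d j ^ N = 1" using finite_order g by auto
  have "\<forall>j. \<exists>x. 0 \<le> x \<and> x < 1 \<and> d j = unit_exp x"
    using N by (intro allI root_of_unity_eq_unit_exp)
  then obtain x where x: "\<And>j. 0 \<le> x j \<and> x j < 1 \<and> d j = unit_exp (x j)"
    by (metis (no_types))
  then have "g = exp_diag (\<chi> j. x j)" by (simp add: d exp_diag_def diag_eq_iff fun_eq_iff)
  then show "\<exists>y\<in>{y \<in> lattice_N G. \<forall>j. 0 \<le> y $ j \<and> y $ j < 1}. g = exp_diag y"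
    using g x by (intro bexI[of _ "\<chi> j. x j"]) (auto simp: lattice_N_iff)
qed (auto simp: lattice_N_iff)

lemma junior_lattice:
  assumes "basic_triangulation (lattice_N G) junior_simplex T"
  shows "junior_lattice (lattice_N G)"
proof
  show axis: "axis j 1 \<in> lattice_N G" for j
  proof -
    have "exp_diag (axis j 1) = mat 1"
      by (auto simp: exp_diag_def axis_def unit_exp_eq_1_iff simp flip: diag_1 intro!: arg_cong[of _ _ diag])
    then show ?thesis using mat_1_mem by (simp add: lattice_N_iff)
  qed
  show "x + y \<in> lattice_N G" if "x \<in> lattice_N G" "y \<in> lattice_N G" for x y
    using mult_mem[of "exp_diag x" "exp_diag y"] that
    by (simp add: lattice_N_iff exp_diag_def diag_mult unit_exp_add)
  show "- x \<in> lattice_N G" if "x \<in> lattice_N G" for x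
    using diag_inverse_mem that by (simp add: lattice_N_iff exp_diag_def unit_exp_minus)
  \<comment> \<open>Determinant 1 says that \<open>unit_exp\<close> takes the value 1 at the
    coordinate sum.\<close>
  show "coord_sum x \<in> \<int>" if "x \<in> lattice_N G" for x
    using det_mem[of "exp_diag x"] that
    by (simp add: lattice_N_iff exp_diag_def det_diag coord_sum_def unit_exp_sum flip: unit_exp_eq_1_iff)
  show "finite {x \<in> lattice_N G. \<forall>j. 0 \<le> x $ j \<and> x $ j < 1}"
    using bij_betw_finite[OF bij_betw_exp_diag] finite by blast
  show "\<exists>M. size M = i \<and> set_mset M \<subseteq> junior_simplex \<inter> lattice_N G \<and> \<Sum>\<^sub># M = y"
    if "y \<in> lattice_N G" "\<forall>j. 0 \<le> y $ j" "coord_sum y = real i" for y i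
    using basic_triangulation_generates[OF assms axis lattice_N_rational that] .
qed

text \<open>The description in \<open>gamma\<close> asks for a rational exponent, which
  \<open>lattice_N_Rats\<close> supplies.\<close>

lemma age_exp_diag:
  assumes "y \<in> lattice_N G" "\<forall>j. 0 \<le> y $ j \<and> y $ j < 1"
  shows "age (exp_diag y) = coord_sum y"
proof -
  have "gamma (exp_diag y) j = y $ j" for j
    unfolding gamma_def unit_exp_def[symmetric]
    using assms lattice_N_Rats by (intro the_equality) (auto simp: exp_diag_def intro: unit_exp_inj)
  then show ?thesis by (simp add: age_def coord_sum_def)
qed

lemma ht_exp_diag:
  assumes "\<forall>j. 0 \<le> y $ j \<and> y $ j < 1"
  shows "ht (exp_diag y) = card (support y)"
proof -
  have "exp_diag y - mat 1 = diag (\<lambda>j. unit_exp (y $ j) - 1)"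
    by (auto simp: vec_eq_iff exp_diag_def mat_def)
  moreover have "unit_exp (y $ j) = 1 \<longleftrightarrow> y $ j = 0" for j
    using assms unit_exp_inj[of "y $ j" 0] by auto
  ultimately show ?thesis by (simp add: ht_def rank_diag support_def)
qed

end

section \<open>Transfer of the bounds from lattice points to group elements\<close>

theorem theorem9p3:
  fixes G :: "(complex^'n^'n) set"
  assumes dim: "CARD('n) \<ge> 4"
    and subgrp: "subgroup G special_linear"
    and fin: "finite G"
    and diagonal: "\<forall>g\<in>G. is_diagonal g"
    and basic: "\<exists>T. basic_triangulation (lattice_N G) junior_simplex T"
  shows "(CARD('n) = 4 \<longrightarrow>
           int (card G) \<le> int (cyclic_polytope_facets 4 (card (junior_simplex \<inter> lattice_N G)))
             - 2 * int (card (age_ht_class G 1 2)) - int (card (age_ht_class G 1 3)) - 1)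
       \<and> (CARD('n) \<ge> 5 \<longrightarrow>
           int (card G) \<le> int (cyclic_polytope_facets CARD('n) (card (junior_simplex \<inter> lattice_N G)))
             - (\<Sum>k = 2..CARD('n) - 1. int (card (age_ht_class G 1 k))) - 1)"
proof -
  interpret G: diagonal_group G
    using subgrp fin diagonal by (rule diagonal_group.intro)
  interpret N: junior_lattice "lattice_N G"
    using basic G.junior_lattice by blast
  have bij: "bij_betw exp_diag N.cube G"
    unfolding N.cube_def by (rule G.bij_betw_exp_diag)
  have card_G: "card G = card N.cube"
    using bij_betw_same_card[OF bij] by simp
  have card_class: "card (age_ht_class G 1 k) = card (N.juniors_of_height k)" for k
  proof -
    have "age (exp_diag y) = coord_sum y" "ht (exp_diag y) = card (support y)" if "y \<in> N.cube" for y
      using that by (auto simp: N.cube_def intro: G.age_exp_diag G.ht_exp_diag)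
    then have "{g \<in> exp_diag ` N.cube. age g = real 1 \<and> ht g = k} = exp_diag ` N.juniors_of_height k"
      by (auto simp: N.juniors_of_height_def N.level_def)
    then have "age_ht_class G 1 k = exp_diag ` N.juniors_of_height k"
      by (simp only: age_ht_class_def bij_betw_imp_surj_on[OF bij])
    moreover have "inj_on exp_diag (N.juniors_of_height k)"
      using bij_betw_imp_inj_on[OF bij]
      by (rule inj_on_subset) (auto simp: N.juniors_of_height_def N.level_def)
    ultimately show ?thesis by (simp add: card_image)
  qed
  have "int (card N.cube + (\<Sum>k = 2..CARD('n) - 1. card (N.juniors_of_height k)) + 1)
      \<le> int (cyclic_polytope_facets CARD('n) (card (N.level 1) + CARD('n)))"
    using N.card_cube_le dim by (simp only: of_nat_le_iff)
  moreover have "int (card N.cube + 2 * card (N.juniors_of_height 2) + card (N.juniors_of_height 3) + 1)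
      \<le> int (cyclic_polytope_facets 4 (card (N.level 1) + 4))" if "CARD('n) = 4"
    using N.card_cube_le_dim_4[OF that] by (simp only: of_nat_le_iff)
  ultimately show ?thesis
    unfolding card_G card_class N.card_junior_simplex_Int_lattice by auto
qed

end
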